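(* There is a polynomial $p$ such that for every $n>1$ and every choice of functions $r,s:[n]^3\to[n]$ satisfying the guard conditions below, the set of clauses $\mathrm{GGT}_n$ (built with these $r,s$) has a pool resolution refutation with at most $p(n)$ clauses. (In short: the guarded graph tautology principles $\mathrm{GGT}_n$ have polynomial size pool resolution refutations.)
   Context: Let $[n]=\{0,1,\dots,n-1\}$. The propositional variables are $x_{i,j}$ for $i,j\in[n]$, $i\neq j$, with the convention that $x_{i,j}$ and $\overline x_{j,i}$ (the negation of $x_{j,i}$) are the same literal. A clause is a set of literals (read as their disjunction); $\Box$ denotes the empty clause. For distinct $i,j,k$ let $T_{i,j,k}=\overline x_{i,j}\lor\overline x_{j,k}\lor\overline x_{k,i}$. Let $r,s:[n]^3\to[n]$ be functions such that for all distinct $i,j,k$: $r(i,j,k)\neq s(i,j,k)$, $\{r(i,j,k),s(i,j,k)\}\not\subseteq\{i,j,k\}$, and $r(i,j,k)=r(j,k,i)=r(k,i,j)$ and likewise for $s$. The guarded graph tautology $\mathrm{GGT}_n$ consists of: (a) for each $i<n$ the clause $\bigvee_{j\neq i}x_{j,i}$; (b) for all distinct $i,j,k\in[n]$, with $r=r(i,j,k)$, $s=s(i,j,k)$, the two clauses $T_{i,j,k}\lor x_{r,s}$ and $T_{i,j,k}\lor\overline x_{r,s}$. Resolution: from $A'\lor x$ and $B'\lor\overline x$ (with $\overline x\notin A'\lor x$, $x\notin B'\lor \overline x$) infer $A'\lor B'$; $x$ is the resolution variable. For a binary tree $T$, the postorder $<_T$ is defined by: if $v$ is in the subtree of the left child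 of $u$ and $w$ is in the subtree of the right child of $u$, then $v<_T w<_T u$. A pool resolution proof from a clause set $F$ is a binary tree $T$ such that (a) each leaf is labeled either with a clause of $F$ or with a clause (a "lemma") that labels some node earlier in the $<_T$ order; (b) each internal node is labeled with a clause and a literal, the clause being obtained by resolution on that literal from the clauses at its two children; (c) the tree is regular: along any path from the root to a leaf, each variable is used as a resolution variable at most once; (d) the root is labeled with the conclusion. A pool resolution refutation is one whose root is labeled $\Box$. Size is the number of clauses (nodes). *)

theory Defs
  imports "HOL-Computational_Algebra.Polynomial"
begin

datatype 'v literal = Pos (var_of: 'v) | Neg (var_of: 'v)

fun complement :: "'v literal \<Rightarrow> 'v literal" where
  "complement (Pos v) = Neg v"
| "complement (Neg v) = Pos v"

type_synonym 'v clause = "'v literal set"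

text \<open>
  The first parent contains the resolution literal \<open>l\<close>, which may have either polarity, so both
  orders of the two parents are covered. In the notation \<open>A' \<or> l\<close>, \<open>B' \<or> complement l\<close> the
  clause \<open>A'\<close> is the first parent without \<open>l\<close>, and \<open>B'\<close> the second one without \<open>complement l\<close>.
\<close>

definition resolves_to :: "'v literal \<Rightarrow> 'v clause \<Rightarrow> 'v clause \<Rightarrow> 'v clause \<Rightarrow> bool" where
  "resolves_to l A B C \<longleftrightarrow>
     l \<in> A \<and> complement l \<notin> A \<and> complement l \<in> B \<and> l \<notin> B \<and>
     C = (A - {l}) \<union> (B - {complement l})"

datatype 'v proof_tree =
    Leaf (label: "'v clause")
  | Node (label: "'v clause") "'v literal" "'v proof_tree" "'v proof_tree"

text \<open>
  A node is represented by the subtree rooted at it; distinct nodes with equal subtrees are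
  distinguished by their index in the postorder list.
\<close>

fun postorder :: "'v proof_tree \<Rightarrow> 'v proof_tree list" where
  "postorder (Leaf C) = [Leaf C]"
| "postorder (Node C l L R) = postorder L @ postorder R @ [Node C l L R]"

definition proof_size :: "'v proof_tree \<Rightarrow> nat" where
  "proof_size t = length (postorder t)"

definition leaves_justified :: "'v clause set \<Rightarrow> 'v proof_tree \<Rightarrow> bool" where
  "leaves_justified F t \<longleftrightarrow>
     (\<forall>k < length (postorder t). \<forall>C. postorder t ! k = Leaf C \<longrightarrow>
        C \<in> F \<or> (\<exists>m < k. label (postorder t ! m) = C))"

definition inferences_correct :: "'v proof_tree \<Rightarrow> bool" where
  "inferences_correct t \<longleftrightarrow>
     (\<forall>C l L R. Node C l L R \<in> set (postorder t) \<longrightarrow> resolves_to l (label L) (label R) C)"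

text \<open>The sequences of resolution literals along the paths from the root to a leaf.\<close>

fun branches :: "'v proof_tree \<Rightarrow> 'v literal list set" where
  "branches (Leaf C) = {[]}"
| "branches (Node C l L R) = (\<lambda>ls. l # ls) ` (branches L \<union> branches R)"

definition regular :: "'v proof_tree \<Rightarrow> bool" where
  "regular t \<longleftrightarrow> (\<forall>ls \<in> branches t. distinct (map var_of ls))"

definition pool_resolution_proof :: "'v clause set \<Rightarrow> 'v clause \<Rightarrow> 'v proof_tree \<Rightarrow> bool" where
  "pool_resolution_proof F C t \<longleftrightarrow>
     leaves_justified F t \<and> inferences_correct t \<and> regular t \<and> label t = C"

definition pool_resolution_refutation :: "'v clause set \<Rightarrow> 'v proof_tree \<Rightarrow> bool" where
  "pool_resolution_refutation F t \<longleftrightarrow> pool_resolution_proof F {} t"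

text \<open>
  The variables are the pairs \<open>(i, j)\<close> with \<open>i < j\<close>; the literal \<open>xlit j i\<close> is then the complement of
  \<open>xlit i j\<close> for all \<open>i \<noteq> j\<close>. The value \<open>xlit i i\<close> is junk and never used below.
\<close>

definition xlit :: "nat \<Rightarrow> nat \<Rightarrow> (nat \<times> nat) literal" where
  "xlit i j = (if i < j then Pos (i, j) else Neg (j, i))"

lemma complement_xlit: "i \<noteq> j \<Longrightarrow> complement (xlit i j) = xlit j i"
  by (auto simp: xlit_def)

definition T_clause :: "nat \<Rightarrow> nat \<Rightarrow> nat \<Rightarrow> (nat \<times> nat) clause" where
  "T_clause i j k = {complement (xlit i j), complement (xlit j k), complement (xlit k i)}"

definition distinct_triple :: "nat \<Rightarrow> nat \<Rightarrow> nat \<Rightarrow> nat \<Rightarrow> bool" where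
  "distinct_triple n i j k \<longleftrightarrow> i < n \<and> j < n \<and> k < n \<and> i \<noteq> j \<and> j \<noteq> k \<and> k \<noteq> i"

definition guards ::
  "nat \<Rightarrow> (nat \<Rightarrow> nat \<Rightarrow> nat \<Rightarrow> nat) \<Rightarrow> (nat \<Rightarrow> nat \<Rightarrow> nat \<Rightarrow> nat) \<Rightarrow> bool" where
  "guards n r s \<longleftrightarrow>
     (\<forall>i<n. \<forall>j<n. \<forall>k<n. r i j k < n \<and> s i j k < n) \<and>
     (\<forall>i j k. distinct_triple n i j k \<longrightarrow>
        r i j k \<noteq> s i j k \<and>
        \<not> {r i j k, s i j k} \<subseteq> {i, j, k} \<and>
        r i j k = r j k i \<and> r j k i = r k i j \<and>
        s i j k = s j k i \<and> s j k i = s k i j)"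

definition GGT ::
  "nat \<Rightarrow> (nat \<Rightarrow> nat \<Rightarrow> nat \<Rightarrow> nat) \<Rightarrow> (nat \<Rightarrow> nat \<Rightarrow> nat \<Rightarrow> nat) \<Rightarrow> (nat \<times> nat) clause set" where
  "GGT n r s =
     {{xlit j i | j. j < n \<and> j \<noteq> i} | i. i < n}
     \<union> {T_clause i j k \<union> {xlit (r i j k) (s i j k)} | i j k. distinct_triple n i j k}
     \<union> {T_clause i j k \<union> {complement (xlit (r i j k) (s i j k))} | i j k. distinct_triple n i j k}"

end

theory Submission
  imports Defs
begin

text \<open>
  View the tree as a search that assigns truth values along the path from the root and must derive
  at each node a clause falsified by its path. An open node is described by a set \<open>M\<close> of minimal
  elements and, for every other \<open>k\<close>, one element \<open>p k\<close> of \<open>M\<close> that the path puts below \<open>k\<close>. The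
  polynomial refutation of the unguarded tautology, restricted to \<open>M\<close>, closes the node at
  once if all clauses \<open>T\<close> that it uses are available up to literals falsified by the path. If one of
  them is not, then its guard variable is not on the path (otherwise a guarded clause would serve),
  so one can branch on the variables of \<open>T\<close> and derive it as a lemma. The at most three other
  branches are again open nodes, each with a smaller \<open>M\<close>, after merging the elements above a
  vertex that stopped being minimal into those of a minimal one. Every branching learns a new \<open>T\<close>,
  so there are at most \<open>n ^ 3\<close> of them.
\<close>

section \<open>Literals and their variables\<close>

definition edge :: "nat \<Rightarrow> nat \<Rightarrow> nat \<times> nat" where
  "edge i j = (min i j, max i j)"

lemma var_of_xlit [simp]: "var_of (xlit i j) = edge i j"
  by (auto simp: xlit_def edge_def)

lemma edge_eq_iff [simp]: "edge a b = edge c d \<longleftrightarrow> a = c \<and> b = d \<or> a = d \<and> b = c"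
  by (auto simp: edge_def min_def max_def)

lemma edge_commute: "edge a b = edge b a"
  by auto

lemma xlit_eq_iff [simp]:
  "a \<noteq> b \<Longrightarrow> xlit a b = xlit c d \<longleftrightarrow> a = c \<and> b = d"
  "a \<noteq> b \<Longrightarrow> xlit c d = xlit a b \<longleftrightarrow> a = c \<and> b = d"
  by (auto simp: xlit_def)

lemma xlit_notin: "edge a b \<notin> var_of ` N \<Longrightarrow> xlit a b \<notin> N \<and> xlit b a \<notin> N"
  by (metis edge_commute image_eqI var_of_xlit)

lemma xlit_in_of_edge_in:
  assumes "edge a b \<in> var_of ` N" "a \<noteq> b"
  shows "xlit a b \<in> N \<or> xlit b a \<in> N"
proof -
  obtain l where l: "l \<in> N" "edge a b = var_of l" using assms by auto
  have "l = xlit a b \<or> l = xlit b a"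
    using l(2) assms(2) by (cases l) (auto simp: xlit_def edge_def)
  with l show ?thesis by auto
qed

lemma T_clause_eq:
  "a \<noteq> b \<Longrightarrow> b \<noteq> c \<Longrightarrow> c \<noteq> a \<Longrightarrow> T_clause a b c = {xlit b a, xlit c b, xlit a c}"
  by (simp add: T_clause_def complement_xlit)

section \<open>Pool proofs as a relation that threads the available lemmas\<close>

text \<open>
  In \<open>pool V S C k S'\<close>, the set \<open>V\<close> consists of the variables resolved on between the root and the
  current node, and \<open>S\<close> and \<open>S'\<close> are the clauses usable as leaf labels before and after the subtree
  of size \<open>k\<close> in postorder.
\<close>

inductive pool ::
  "'v set \<Rightarrow> 'v clause set \<Rightarrow> 'v clause \<Rightarrow> nat \<Rightarrow> 'v clause set \<Rightarrow> bool" where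
  leaf: "C \<in> S \<Longrightarrow> pool V S C 1 S"
| node: "pool (insert (var_of l) V) S A k1 S1 \<Longrightarrow> pool (insert (var_of l) V) S1 B k2 S2 \<Longrightarrow>
    resolves_to l A B C \<Longrightarrow> var_of l \<notin> V \<Longrightarrow> pool V S C (Suc (k1 + k2)) (insert C S2)"

lemma pool_mono: "pool V S C k S' \<Longrightarrow> S \<subseteq> S'"
  by (induction rule: pool.induct) auto

lemma pool_label: "pool V S C k S' \<Longrightarrow> C \<in> S'"
  by (induction rule: pool.induct) auto

text \<open>Postorder visits all of \<open>L\<close> before \<open>R\<close>, so every label of
  \<open>L\<close> may serve as a lemma in \<open>R\<close>. The last index is that of the node
  itself, which is not a leaf.\<close>

lemma leaves_justified_Node:
  assumes L: "leaves_justified S L"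
    and R: "leaves_justified (S \<union> label ` set (postorder L)) R"
  shows "leaves_justified S (Node C l L R)"
  unfolding leaves_justified_def
proof (intro allI impI)
  let ?P = "postorder (Node C l L R)"
  fix k D
  assume k: "k < length ?P" and D: "?P ! k = Leaf D"
  show "D \<in> S \<or> (\<exists>m<k. label (?P ! m) = D)"
  proof (cases "k < length (postorder L)")
    case True
    then have "postorder L ! k = Leaf D" using D by (simp add: nth_append)
    with L True have "D \<in> S \<or> (\<exists>m<k. label (postorder L ! m) = D)"
      unfolding leaves_justified_def by blast
    moreover have "label (?P ! m) = label (postorder L ! m)" if "m < k" for m
      using that True by (simp add: nth_append)
    ultimately show ?thesis by metis
  next
    case False
    define k' where "k' = k - length (postorder L)"
    have kk: "k = length (postorder L) + k'" using False by (simp add: k'_def)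
    have k'R: "k' < length (postorder R)"
    proof (rule ccontr)
      assume "\<not> ?thesis"
      then have "k' = length (postorder R)" using k kk by simp
      then show False using D kk by (simp add: nth_append)
    qed
    then have "postorder R ! k' = Leaf D" using D kk by (simp add: nth_append)
    with R k'R have "D \<in> S \<union> label ` set (postorder L) \<or> (\<exists>m<k'. label (postorder R ! m) = D)"
      unfolding leaves_justified_def by blast
    moreover have "\<exists>m<length (postorder L). label (postorder L ! m) = D"
      if "D \<in> label ` set (postorder L)"
      using that by (metis imageE in_set_conv_nth)
    ultimately consider "D \<in> S" | m where "m < length (postorder L)" "label (postorder L ! m) = D"
      | m where "m < k'" "label (postorder R ! m) = D"
      by blast
    then show ?thesis
    proof cases
      case 2
      then show ?thesis using kk by (intro disjI2 exI[of _ m]) (simp add: nth_append)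
    next
      case 3
      then show ?thesis using kk k'R
        by (intro disjI2 exI[of _ "length (postorder L) + m"]) (simp add: nth_append)
    qed simp
  qed
qed

text \<open>Disjointness of the branches from \<open>V\<close> strengthens the induction: for
  \<open>insert (var_of l) V\<close> it says that no branch below the node repeats the variable of
  \<open>l\<close>, which is regularity.\<close>

lemma pool_tree:
  assumes "pool V S C k S'"
  shows "\<exists>t. pool_resolution_proof S C t \<and> proof_size t = k \<and>
    S' = S \<union> label ` set (postorder t) \<and> (\<forall>ls\<in>branches t. var_of ` set ls \<inter> V = {})"
  using assms
proof (induction rule: pool.induct)
  case (leaf C S V)
  then show ?case
    by (intro exI[of _ "Leaf C"])
      (auto simp: pool_resolution_proof_def proof_size_def leaves_justified_def
        inferences_correct_def regular_def)
next
  case (node l V S A k1 S1 B k2 S2 C)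
  obtain L where L: "pool_resolution_proof S A L" "proof_size L = k1"
    "S1 = S \<union> label ` set (postorder L)"
    "\<forall>ls\<in>branches L. var_of ` set ls \<inter> insert (var_of l) V = {}" using node.IH by blast
  obtain R where R: "pool_resolution_proof S1 B R" "proof_size R = k2"
    "S2 = S1 \<union> label ` set (postorder R)"
    "\<forall>ls\<in>branches R. var_of ` set ls \<inter> insert (var_of l) V = {}" using node.IH by blast
  let ?t = "Node C l L R"
  have "leaves_justified S ?t"
    using L R by (intro leaves_justified_Node) (auto simp: pool_resolution_proof_def)
  moreover have "inferences_correct ?t"
    using L R node.hyps by (auto simp: pool_resolution_proof_def inferences_correct_def)
  moreover have "regular ?t"
    using L R by (fastforce simp: pool_resolution_proof_def regular_def)
  ultimately have "pool_resolution_proof S C ?t"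
    by (simp add: pool_resolution_proof_def)
  moreover have "proof_size ?t = Suc (k1 + k2)" using L R by (simp add: proof_size_def)
  moreover have "insert C S2 = S \<union> label ` set (postorder ?t)" using L R by auto
  moreover have "\<forall>ls\<in>branches ?t. var_of ` set ls \<inter> V = {}"
    using L(4) R(4) node.hyps by fastforce
  ultimately show ?case by blast
qed

text \<open>
  There is no weakening rule, so a subtree is only known to derive some clause between \<open>E\<close> and
  \<open>U\<close>: the lower bound guarantees the literals resolved on nearer the root, the upper bound that nothing
  survives to the root.
\<close>

definition derives ::
  "'v set \<Rightarrow> 'v clause set \<Rightarrow> 'v clause \<Rightarrow> 'v clause \<Rightarrow> nat \<Rightarrow> 'v clause set \<Rightarrow> bool" where
  "derives V S E U k S' \<longleftrightarrow> (\<exists>D k'. E \<subseteq> D \<and> D \<subseteq> U \<and> k' \<le> k \<and> pool V S D k' S')"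

lemma derives_mono: "derives V S E U k S' \<Longrightarrow> S \<subseteq> S'"
  by (auto simp: derives_def dest: pool_mono)

lemma derives_label: "derives V S E U k S' \<Longrightarrow> \<exists>D\<in>S'. E \<subseteq> D \<and> D \<subseteq> U"
  by (auto simp: derives_def dest: pool_label)

lemma derives_weaken:
  "derives V S E U k S' \<Longrightarrow> E' \<subseteq> E \<Longrightarrow> U \<subseteq> U' \<Longrightarrow> k \<le> k' \<Longrightarrow> derives V S E' U' k' S'"
  unfolding derives_def by (meson order_trans)

lemma derives_leaf: "D \<in> S \<Longrightarrow> E \<subseteq> D \<Longrightarrow> D \<subseteq> U \<Longrightarrow> derives V S E U 1 S"
  unfolding derives_def by (intro exI[of _ D] exI[of _ 1]) (simp only: pool.leaf order_refl simp_thms)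

text \<open>Presence of the resolution literals in the lower bounds and absence of their complements
  from the upper bounds give \<open>resolves_to\<close> for the actual, unknown parents.\<close>

lemma derives_node:
  assumes 1: "derives (insert (edge a b) V) S E1 U1 k1 S1" "xlit a b \<in> E1" "xlit b a \<notin> U1"
    and 2: "derives (insert (edge a b) V) S1 E2 U2 k2 S2" "xlit b a \<in> E2" "xlit a b \<notin> U2"
    and "a \<noteq> b" "edge a b \<notin> V"
    and E: "E \<subseteq> (E1 - {xlit a b}) \<union> (E2 - {xlit b a})"
    and U: "(U1 - {xlit a b}) \<union> (U2 - {xlit b a}) \<subseteq> U"
    and k: "k1 + k2 + 1 \<le> k"
  shows "\<exists>S'. derives V S E U k S' \<and> S2 \<subseteq> S'"
proof -
  obtain D1 j1 where D1: "E1 \<subseteq> D1" "D1 \<subseteq> U1" "j1 \<le> k1" "pool (insert (edge a b) V) S D1 j1 S1"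
    using 1 by (auto simp: derives_def)
  obtain D2 j2 where D2: "E2 \<subseteq> D2" "D2 \<subseteq> U2" "j2 \<le> k2" "pool (insert (edge a b) V) S1 D2 j2 S2"
    using 2 by (auto simp: derives_def)
  let ?D = "(D1 - {xlit a b}) \<union> (D2 - {xlit b a})"
  have "resolves_to (xlit a b) D1 D2 ?D"
    using 1 2 D1 D2 \<open>a \<noteq> b\<close> by (auto simp: resolves_to_def complement_xlit)
  then have "pool V S ?D (Suc (j1 + j2)) (insert ?D S2)"
    using D1 D2 assms by (intro pool.node) auto
  moreover have "E \<subseteq> ?D" "?D \<subseteq> U" using E U D1 D2 by blast+
  moreover have "Suc (j1 + j2) \<le> k" using k D1 D2 by simp
  ultimately have "derives V S E U k (insert ?D S2)" unfolding derives_def by blast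
  then show ?thesis by blast
qed

text \<open>Such a clause can stand in for \<open>E\<close> at a node whose path falsifies
  \<open>N\<close>, because surplus literals from \<open>N\<close> are resolved on nearer the
  root.\<close>

definition avail :: "'v clause set \<Rightarrow> 'v clause \<Rightarrow> 'v clause \<Rightarrow> bool" where
  "avail S N E \<longleftrightarrow> (\<exists>D\<in>S. E \<subseteq> D \<and> D \<subseteq> E \<union> N)"

lemma avail_mono: "avail S N E \<Longrightarrow> S \<subseteq> S' \<Longrightarrow> avail S' N E"
  by (auto simp: avail_def)

lemma derives_avail: "avail S N E \<Longrightarrow> derives V S E (E \<union> N) 1 S"
  unfolding avail_def using derives_leaf by metis

text \<open>The literals \<open>xlit k h\<close> are resolved away one by one against side clauses
  used as leaves, at two nodes per element. The last condition keeps side clauses from bringing back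
  a literal that the chain removes.\<close>

lemma derives_chain:
  assumes "finite K"
    and "derives (V \<union> (\<lambda>k. edge k h) ` K) S E U m S1"
    and "h \<notin> K" "N \<subseteq> U"
    and "\<And>k. k \<in> K \<Longrightarrow> edge k h \<notin> V \<and> edge k h \<notin> var_of ` N \<and> xlit k h \<in> E \<and> xlit h k \<notin> U"
    and "\<And>k. k \<in> K \<Longrightarrow> avail S N (insert (xlit h k) (R k))"
    and "\<And>k k'. k \<in> K \<Longrightarrow> k' \<in> K \<Longrightarrow> edge k h \<notin> var_of ` R k'"
  shows "\<exists>S2. derives V S ((E - (\<lambda>k. xlit k h) ` K) \<union> \<Union> (R ` K))
    ((U - (\<lambda>k. xlit k h) ` K) \<union> \<Union> (R ` K)) (m + 2 * card K) S2 \<and> S1 \<subseteq> S2"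
  using assms
proof (induction K arbitrary: V)
  case empty
  then show ?case by auto
next
  case (insert x F)
  \<comment> \<open>\<open>x\<close> is resolved on last, hence nearest the root, so its variable
    counts as used for the rest of the chain.\<close>
  have "\<exists>S2. derives (insert (edge x h) V) S ((E - (\<lambda>k. xlit k h) ` F) \<union> \<Union> (R ` F))
      ((U - (\<lambda>k. xlit k h) ` F) \<union> \<Union> (R ` F)) (m + 2 * card F) S2 \<and> S1 \<subseteq> S2"
  proof (rule insert.IH)
    show "derives (insert (edge x h) V \<union> (\<lambda>k. edge k h) ` F) S E U m S1"
      using insert.prems(1) by (simp add: Un_insert_right)
  qed (use insert in auto)
  then obtain S2 where S2: "derives (insert (edge x h) V) S ((E - (\<lambda>k. xlit k h) ` F) \<union> \<Union> (R ` F))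
      ((U - (\<lambda>k. xlit k h) ` F) \<union> \<Union> (R ` F)) (m + 2 * card F) S2" "S1 \<subseteq> S2" by blast
  have xh: "x \<noteq> h" using insert by auto
  have "avail S2 N (insert (xlit h x) (R x))"
    using insert.prems(5)[of x] derives_mono[OF S2(1)] by (auto intro: avail_mono)
  then have side: "derives (insert (edge x h) V) S2 (insert (xlit h x) (R x))
      (insert (xlit h x) (R x) \<union> N) 1 S2"
    using derives_avail by blast
  have xN: "xlit x h \<notin> N" using insert.prems(4)[of x] xlit_notin by blast
  have Rx: "xlit x h \<notin> R k \<and> xlit h x \<notin> R k" if "k \<in> insert x F" for k
    using insert.prems(6)[of x k] that xlit_notin by blast
  have Fx: "xlit k h \<notin> R x \<and> xlit k h \<notin> N" if "k \<in> F" for k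
    using insert.prems(6)[of k x] insert.prems(4)[of k] that xlit_notin by blast
  have "\<exists>S'. derives V S ((E - (\<lambda>k. xlit k h) ` insert x F) \<union> \<Union> (R ` insert x F))
    ((U - (\<lambda>k. xlit k h) ` insert x F) \<union> \<Union> (R ` insert x F)) (m + 2 * card (insert x F)) S'
    \<and> S2 \<subseteq> S'"
  proof (rule derives_node[OF S2(1) _ _ side])
    show "xlit x h \<in> (E - (\<lambda>k. xlit k h) ` F) \<union> \<Union> (R ` F)"
      using insert xh by auto
    show "xlit h x \<notin> (U - (\<lambda>k. xlit k h) ` F) \<union> \<Union> (R ` F)"
      using insert.prems(4)[of x] Rx by auto
    show "xlit x h \<notin> insert (xlit h x) (R x) \<union> N" using xN Rx[of x] xh by auto
    show "edge x h \<notin> V" using insert.prems(4)[of x] by auto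
    show "E - (\<lambda>k. xlit k h) ` insert x F \<union> \<Union> (R ` insert x F) \<subseteq>
      (E - (\<lambda>k. xlit k h) ` F \<union> \<Union> (R ` F)) - {xlit x h} \<union>
      (insert (xlit h x) (R x) - {xlit h x})"
      using Rx by auto
    show "U - (\<lambda>k. xlit k h) ` F \<union> \<Union> (R ` F) - {xlit x h} \<union>
      (insert (xlit h x) (R x) \<union> N - {xlit h x})
      \<subseteq> U - (\<lambda>k. xlit k h) ` insert x F \<union> \<Union> (R ` insert x F)"
      using Rx Fx xN insert.prems(3) by auto
  qed (use insert xh in auto)
  with S2(2) show ?case by blast
qed

section \<open>Refuting the tautology above a set of minimal elements\<close>

text \<open>
  \<open>N\<close> is the set of literals falsified by the path; \<open>xlit k (p k) \<in> N\<close> thus means that \<open>p k\<close> lies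
  below \<open>k\<close>. The last condition says that the path has otherwise only queried pairs of non-minimal
  elements, which the direct refutation never resolves on.
\<close>

definition star ::
  "nat \<Rightarrow> nat set \<Rightarrow> (nat \<Rightarrow> nat) \<Rightarrow> (nat \<times> nat) clause \<Rightarrow> bool" where
  "star n M p N \<longleftrightarrow> M \<subseteq> {..<n} \<and> M \<noteq> {} \<and>
     (\<forall>k<n. k \<notin> M \<longrightarrow> p k \<in> M \<and> xlit k (p k) \<in> N) \<and>
     (\<forall>a\<in>M. \<forall>b. a \<noteq> b \<longrightarrow> edge a b \<in> var_of ` N \<longrightarrow> b \<notin> M \<and> p b = a)"

text \<open>The clause that an open node has to derive.\<close>

definition rays :: "nat \<Rightarrow> nat set \<Rightarrow> (nat \<Rightarrow> nat) \<Rightarrow> (nat \<times> nat) clause" where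
  "rays n M p = (\<lambda>k. xlit k (p k)) ` ({..<n} - M)"

text \<open>The first family eliminates elements of \<open>M\<close> from minimality clauses; the
  second replaces \<open>xlit k i\<close> by \<open>xlit (p k) i\<close> at the expense of a
  ray.\<close>

definition needed :: "nat \<Rightarrow> nat set \<Rightarrow> (nat \<Rightarrow> nat) \<Rightarrow> (nat \<times> nat) clause set" where
  "needed n M p =
     {T_clause a b c | a b c. a \<in> M \<and> b \<in> M \<and> c \<in> M \<and> a \<noteq> b \<and> b \<noteq> c \<and> c \<noteq> a} \<union>
     {T_clause (p k) k i | k i. k < n \<and> k \<notin> M \<and> i \<in> M \<and> i \<noteq> p k}"

lemma rays_subset: "star n M p N \<Longrightarrow> rays n M p \<subseteq> N"
  by (auto simp: rays_def star_def)

section \<open>Cyclic clauses from their guarded pairs\<close>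

locale ggt =
  fixes n :: nat and r s :: "nat \<Rightarrow> nat \<Rightarrow> nat \<Rightarrow> nat"
  assumes guards: "guards n r s"
begin

lemma guarded_clauses:
  assumes "distinct_triple n a b c"
  shows "insert (xlit (r a b c) (s a b c)) (T_clause a b c) \<in> GGT n r s"
    and "insert (xlit (s a b c) (r a b c)) (T_clause a b c) \<in> GGT n r s"
    and "r a b c \<noteq> s a b c"
    and "edge (r a b c) (s a b c) \<notin> var_of ` T_clause a b c"
proof -
  show ne: "r a b c \<noteq> s a b c" using assms guards by (auto simp: guards_def)
  show "insert (xlit (r a b c) (s a b c)) (T_clause a b c) \<in> GGT n r s"
    using assms unfolding GGT_def by blast
  have "insert (complement (xlit (r a b c) (s a b c))) (T_clause a b c) \<in> GGT n r s"
    using assms unfolding GGT_def by blast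
  then show "insert (xlit (s a b c) (r a b c)) (T_clause a b c) \<in> GGT n r s"
    using ne by (simp add: complement_xlit)
  have "\<not> {r a b c, s a b c} \<subseteq> {a, b, c}"
    using assms guards unfolding guards_def by blast
  then show "edge (r a b c) (s a b c) \<notin> var_of ` T_clause a b c"
    using assms by (auto simp: distinct_triple_def T_clause_eq)
qed

text \<open>The guarded clauses are resolved on the guard variable. The upper bound is not
  \<open>N\<close>, so exactly the cyclic clause is learned and the lemma is not tied to the current
  path.\<close>

lemma learn_T:
  assumes T: "distinct_triple n a b c" and "GGT n r s \<subseteq> S"
    and N: "T_clause a b c \<subseteq> N" "edge (r a b c) (s a b c) \<notin> var_of ` N"
  shows "\<exists>S'. derives (var_of ` N) S (T_clause a b c) (T_clause a b c) 3 S'"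
proof -
  let ?T = "T_clause a b c" and ?r = "r a b c" and ?s = "s a b c"
  let ?V = "insert (edge ?r ?s) (var_of ` N)"
  note G = guarded_clauses[OF T]
  have 1: "derives ?V S (insert (xlit ?r ?s) ?T) (insert (xlit ?r ?s) ?T) 1 S"
    using G(1) assms(2) by (blast intro: derives_leaf[OF _ order_refl order_refl])
  have 2: "derives ?V S (insert (xlit ?s ?r) ?T) (insert (xlit ?s ?r) ?T) 1 S"
    using G(2) assms(2) by (blast intro: derives_leaf[OF _ order_refl order_refl])
  have "xlit ?r ?s \<notin> ?T" "xlit ?s ?r \<notin> ?T"
    using xlit_notin[OF G(4)] by auto
  then have "\<exists>S'. derives (var_of ` N) S ?T ?T 3 S' \<and> S \<subseteq> S'"
    by (intro derives_node[OF 1 _ _ 2]) (use G(3) N(2) in auto)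
  then show ?thesis by blast
qed

text \<open>If the guard variable is already on the path, regularity forbids resolving on it, but
  then one of the guarded clauses is contained in \<open>N\<close> and serves as a leaf.\<close>

lemma refute_T:
  assumes T: "distinct_triple n a b c" and "GGT n r s \<subseteq> S" and N: "T_clause a b c \<subseteq> N"
  shows "\<exists>S'. derives (var_of ` N) S (T_clause a b c) N 3 S'"
proof (cases "edge (r a b c) (s a b c) \<in> var_of ` N")
  case True
  note G = guarded_clauses[OF T]
  have "xlit (r a b c) (s a b c) \<in> N \<or> xlit (s a b c) (r a b c) \<in> N"
    using xlit_in_of_edge_in True G(3) by blast
  then obtain D where "D \<in> S" "T_clause a b c \<subseteq> D" "D \<subseteq> N"
  proof
    assume "xlit (r a b c) (s a b c) \<in> N"
    then show thesis using N by (intro that[OF subsetD[OF assms(2) G(1)]]) auto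
  next
    assume "xlit (s a b c) (r a b c) \<in> N"
    then show thesis using N by (intro that[OF subsetD[OF assms(2) G(2)]]) auto
  qed
  then have "derives (var_of ` N) S (T_clause a b c) N 1 S"
    by (rule derives_leaf)
  then have "derives (var_of ` N) S (T_clause a b c) N 3 S"
    by (rule derives_weaken) auto
  then show ?thesis ..
next
  case False
  then obtain S' where "derives (var_of ` N) S (T_clause a b c) (T_clause a b c) 3 S'"
    using learn_T[OF T assms(2) N] by blast
  then have "derives (var_of ` N) S (T_clause a b c) N 3 S'"
    by (rule derives_weaken) (use N in auto)
  then show ?thesis ..
qed

lemma not_avail:
  assumes T: "distinct_triple n a b c" and "GGT n r s \<subseteq> S" and "\<not> avail S N (T_clause a b c)"
  shows "edge (r a b c) (s a b c) \<notin> var_of ` N" and "T_clause a b c \<notin> S"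
proof -
  note G = guarded_clauses[OF T]
  show "T_clause a b c \<notin> S" using assms(3) by (auto simp: avail_def)
  show "edge (r a b c) (s a b c) \<notin> var_of ` N"
  proof
    assume "edge (r a b c) (s a b c) \<in> var_of ` N"
    then have "xlit (r a b c) (s a b c) \<in> N \<or> xlit (s a b c) (r a b c) \<in> N"
      using xlit_in_of_edge_in G(3) by blast
    then have "avail S N (T_clause a b c)"
    proof
      assume "xlit (r a b c) (s a b c) \<in> N"
      then show ?thesis unfolding avail_def by (intro bexI[OF _ subsetD[OF assms(2) G(1)]]) auto
    next
      assume "xlit (s a b c) (r a b c) \<in> N"
      then show ?thesis unfolding avail_def by (intro bexI[OF _ subsetD[OF assms(2) G(2)]]) auto
    qed
    with assms(3) show False ..
  qed
qed

end

section \<open>Direct refutation when all needed clauses are available\<close>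

locale ggt_star = ggt n r s for n r s +
  fixes M p N S0
  assumes star: "star n M p N"
    and GGT_S0: "GGT n r s \<subseteq> S0"
    and needed_avail: "\<And>E. E \<in> needed n M p \<Longrightarrow> avail S0 N E"
begin

lemma M_less: "a \<in> M \<Longrightarrow> a < n"
  using star by (auto simp: star_def)

lemma p_in: "k < n \<Longrightarrow> k \<notin> M \<Longrightarrow> p k \<in> M \<and> xlit k (p k) \<in> N"
  using star by (auto simp: star_def)

lemma edge_in_N: "edge a b \<in> var_of ` N \<Longrightarrow> a \<in> M \<Longrightarrow> a \<noteq> b \<Longrightarrow> b \<notin> M \<and> p b = a"
  using star unfolding star_def by blast

lemma finite_M: "finite M"
  using star finite_subset[of M "{..<n}"] by (auto simp: star_def)

text \<open>The axiom for \<open>i\<close> relativised to \<open>W\<close>: something in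
  \<open>W\<close> lies below \<open>i\<close>, provided the order that the path assumes through the
  rays holds.\<close>

definition min_clause :: "nat set \<Rightarrow> nat \<Rightarrow> (nat \<times> nat) clause" where
  "min_clause W i = rays n M p \<union> (\<lambda>j. xlit j i) ` (W - {i})"

text \<open>The pairs are those that the direct refutation may still resolve on, \<open>X\<close>
  being the elements eliminated within the subtree.\<close>

definition free :: "nat set \<Rightarrow> (nat \<times> nat) set \<Rightarrow> bool" where
  "free X V \<longleftrightarrow> (\<forall>k<n. k \<notin> M \<longrightarrow> (\<forall>i\<in>M. p k \<noteq> i \<longrightarrow> edge k i \<notin> V)) \<and>
     (\<forall>u\<in>X. \<forall>j\<in>M. u \<noteq> j \<longrightarrow> edge u j \<notin> V)"

text \<open>Start from the axiom for \<open>i\<close>. If \<open>p k\<close> is below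
  \<open>k\<close> and \<open>k\<close> below \<open>i\<close>, then \<open>p k\<close> is below
  \<open>i\<close>; so \<open>T_clause (p k) k i\<close> exchanges \<open>xlit k i\<close> for the
  ray of \<open>k\<close> and \<open>xlit (p k) i\<close>. If \<open>p k = i\<close>, the literal is
  a ray already.\<close>

lemma derives_min_clause_M:
  assumes i: "i \<in> M" and V: "free X V" and S: "S0 \<subseteq> S"
  shows "\<exists>S'. derives V S (min_clause M i) (min_clause M i \<union> N) (2 * n + 1) S'"
proof -
  define K where "K = {k. k < n \<and> k \<notin> M \<and> p k \<noteq> i}"
  define E where "E = {xlit j i | j. j < n \<and> j \<noteq> i}"
  define R where "R k = {xlit k (p k), xlit (p k) i}" for k
  have K: "k < n" "k \<notin> M" "p k \<noteq> i" "p k \<in> M" "k \<noteq> i" "k \<noteq> p k" if "k \<in> K" for k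
    using that p_in[of k] i by (auto simp: K_def)
  have "finite K" "card K \<le> n"
    using card_mono[of "{..<n}" K] by (auto simp: K_def)
  have "E \<in> {{xlit j i | j. j < n \<and> j \<noteq> i} | i. i < n}"
    unfolding E_def using M_less[OF i] by (intro CollectI exI[of _ i]) simp
  then have "E \<in> GGT n r s"
    unfolding GGT_def by (intro UnI1)
  then have "E \<in> S" using S GGT_S0 by auto
  then have "derives (V \<union> (\<lambda>k. edge k i) ` K) S E (E \<union> N) 1 S"
    by (rule derives_leaf) auto
  have edgeN: "edge k i \<notin> var_of ` N" if "k \<in> K" for k
    using edge_in_N[of i k] K[OF that] i by (auto simp: edge_commute)
  have "\<exists>S2. derives V S ((E - (\<lambda>k. xlit k i) ` K) \<union> \<Union> (R ` K))
    (((E \<union> N) - (\<lambda>k. xlit k i) ` K) \<union> \<Union> (R ` K)) (1 + 2 * card K) S2 \<and> S \<subseteq> S2"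
  proof (rule derives_chain)
    show "derives (V \<union> (\<lambda>k. edge k i) ` K) S E (E \<union> N) 1 S" by fact
    show "edge k i \<notin> V \<and> edge k i \<notin> var_of ` N \<and> xlit k i \<in> E \<and> xlit i k \<notin> E \<union> N"
      if "k \<in> K" for k
      using that V i K[OF that] edgeN[OF that] xlit_notin[OF edgeN[OF that]]
      by (auto simp: free_def E_def)
    show "avail S N (insert (xlit i k) (R k))" if "k \<in> K" for k
    proof -
      have "T_clause (p k) k i \<in> needed n M p"
        using K[OF that] i unfolding needed_def by auto
      then have "avail S N (T_clause (p k) k i)"
        using needed_avail S avail_mono by blast
      then show ?thesis using K[OF that] by (simp add: T_clause_eq R_def insert_commute)
    qed
    show "edge k i \<notin> var_of ` R k'" if "k \<in> K" "k' \<in> K" for k k'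
      using K[OF that(1)] K[OF that(2)] by (auto simp: R_def)
  qed (use \<open>finite K\<close> i in \<open>auto simp: K_def\<close>)
  then obtain S2 where S2: "derives V S ((E - (\<lambda>k. xlit k i) ` K) \<union> \<Union> (R ` K))
    (((E \<union> N) - (\<lambda>k. xlit k i) ` K) \<union> \<Union> (R ` K)) (1 + 2 * card K) S2" by blast
  have "derives V S (min_clause M i) (min_clause M i \<union> N) (2 * n + 1) S2"
  proof (rule derives_weaken[OF S2])
    show "min_clause M i \<subseteq> (E - (\<lambda>k. xlit k i) ` K) \<union> \<Union> (R ` K)"
    proof
      fix l assume "l \<in> min_clause M i"
      then consider k where "k < n" "k \<notin> M" "l = xlit k (p k)" | j where "j \<in> M" "j \<noteq> i" "l = xlit j i"
        by (auto simp: min_clause_def rays_def)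
      then show "l \<in> (E - (\<lambda>k. xlit k i) ` K) \<union> \<Union> (R ` K)"
      proof cases
        case 1
        show ?thesis
        proof (cases "p k = i")
          case True
          have "k \<noteq> i" using 1 i by auto
          then have "l \<in> E" "l \<notin> (\<lambda>k. xlit k i) ` K"
            using 1 True by (auto simp: E_def K_def)
          then show ?thesis by auto
        next
          case False
          then show ?thesis using 1 by (auto simp: R_def K_def)
        qed
      next
        case 2
        then show ?thesis using M_less by (auto simp: E_def K_def)
      qed
    qed
    show "((E \<union> N) - (\<lambda>k. xlit k i) ` K) \<union> \<Union> (R ` K) \<subseteq> min_clause M i \<union> N"
    proof
      fix l assume "l \<in> ((E \<union> N) - (\<lambda>k. xlit k i) ` K) \<union> \<Union> (R ` K)"
      then consider j where "j < n" "j \<noteq> i" "j \<notin> K" "l = xlit j i" | "l \<in> N"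
        | k where "k \<in> K" "l = xlit k (p k)" | k where "k \<in> K" "l = xlit (p k) i"
        by (auto simp: E_def R_def)
      then show "l \<in> min_clause M i \<union> N"
      proof cases
        case 1
        then show ?thesis by (auto simp: K_def min_clause_def rays_def)
      next
        case 3
        then show ?thesis using K(1,2)[OF 3(1)] by (auto simp: min_clause_def rays_def)
      next
        case 4
        then show ?thesis using K(3,4)[OF 4(1)] by (auto simp: min_clause_def)
      qed simp
    qed
  qed (use \<open>card K \<le> n\<close> in auto)
  then show ?thesis by blast
qed

text \<open>
  The list holds the elements of \<open>M\<close> eliminated so far, the latest first. In the refutation graph the
  minimality clause of \<open>u\<close> just before its elimination is the only clause used more than once, so
  these are the only lemmas needed.
\<close>

fun diag :: "nat list \<Rightarrow> (nat \<times> nat) clause set \<Rightarrow> bool" where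
  "diag [] S \<longleftrightarrow> True"
| "diag (u # us) S \<longleftrightarrow> avail S N (min_clause (M - set us) u) \<and> diag us S"

lemma diag_mono: "diag us S \<Longrightarrow> S \<subseteq> S' \<Longrightarrow> diag us S'"
  by (induction us) (auto intro: avail_mono)

text \<open>Transitivity again: \<open>T_clause j u i\<close> turns \<open>xlit j u\<close> into
  \<open>xlit j i\<close> at the cost of \<open>xlit i u\<close>. That last literal is left for a
  resolution nearer the root, so its variable already counts as used.\<close>

lemma derives_eliminated:
  assumes W: "W \<subseteq> M" "u \<in> M" "u \<notin> W" "i \<in> W"
    and V: "free {u} V" and S: "S0 \<subseteq> S"
    and D: "derives (V \<union> (\<lambda>j. edge j u) ` W) S
      (min_clause (insert u W) u) (min_clause (insert u W) u \<union> N) m S1"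
  shows "\<exists>S2. derives (insert (edge i u) V) S (insert (xlit i u) (min_clause W i))
    (insert (xlit i u) (min_clause W i) \<union> N) (m + 2 * n) S2 \<and> S1 \<subseteq> S2"
proof -
  define K where "K = W - {i}"
  define E where "E = min_clause (insert u W) u"
  define R where "R j = {xlit i u, xlit j i}" for j
  have K: "j \<in> M" "j \<in> W" "j \<noteq> i" "j \<noteq> u" if "j \<in> K" for j
    using that W by (auto simp: K_def)
  have iu: "i \<noteq> u" "i \<in> M" using W by auto
  have "finite K" "card K \<le> n"
    using W M_less finite_subset[of K "{..<n}"] card_mono[of "{..<n}" K] by (auto simp: K_def)
  have edgeN: "edge a b \<notin> var_of ` N" if "a \<in> M" "b \<in> M" "a \<noteq> b" for a b
    using edge_in_N that by blast
  have rays: "edge a b \<notin> var_of ` rays n M p" if "a \<in> M" "b \<in> M" "a \<noteq> b" for a b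
    using edgeN[OF that] rays_subset[OF star] by blast
  have E: "E = rays n M p \<union> (\<lambda>j. xlit j u) ` W"
    using W by (auto simp: E_def min_clause_def)
  have "\<exists>S2. derives (insert (edge i u) V) S ((E - (\<lambda>k. xlit k u) ` K) \<union> \<Union> (R ` K))
    (((E \<union> N) - (\<lambda>k. xlit k u) ` K) \<union> \<Union> (R ` K)) (m + 2 * card K) S2 \<and> S1 \<subseteq> S2"
  proof (rule derives_chain)
    have "insert (edge i u) V \<union> (\<lambda>k. edge k u) ` K = V \<union> (\<lambda>j. edge j u) ` W"
      using W by (auto simp: K_def simp del: edge_eq_iff)
    then show "derives (insert (edge i u) V \<union> (\<lambda>k. edge k u) ` K) S E (E \<union> N) m S1"
      using D by (simp add: E_def)
    show "edge k u \<notin> insert (edge i u) V \<and> edge k u \<notin> var_of ` N \<and> xlit k u \<in> E \<and>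
      xlit u k \<notin> E \<union> N" if "k \<in> K" for k
    proof -
      have "edge k u \<notin> insert (edge i u) V"
        using K[OF that] V W by (auto simp: free_def edge_commute)
      moreover have "xlit u k \<notin> rays n M p" "xlit u k \<notin> N"
        using rays[of u k] edgeN[of u k] K[OF that] W xlit_notin by blast+
      ultimately show ?thesis using K[OF that] W edgeN by (auto simp: E)
    qed
    show "avail S N (insert (xlit u k) (R k))" if "k \<in> K" for k
    proof -
      have "T_clause k u i \<in> needed n M p"
        using K[OF that] iu W unfolding needed_def by blast
      then have "avail S N (T_clause k u i)"
        using needed_avail S avail_mono by blast
      then show ?thesis using K[OF that] iu by (simp add: T_clause_eq R_def)
    qed
    show "edge k u \<notin> var_of ` R k'" if "k \<in> K" "k' \<in> K" for k k'
      using K[OF that(1)] K[OF that(2)] iu by (auto simp: R_def)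
  qed (use \<open>finite K\<close> W in \<open>auto simp: K_def\<close>)
  then obtain S2 where S2: "derives (insert (edge i u) V) S
    ((E - (\<lambda>k. xlit k u) ` K) \<union> \<Union> (R ` K))
    (((E \<union> N) - (\<lambda>k. xlit k u) ` K) \<union> \<Union> (R ` K)) (m + 2 * card K) S2" "S1 \<subseteq> S2" by blast
  have "rays n M p \<inter> (\<lambda>k. xlit k u) ` K = {}"
  proof -
    have "xlit k u \<notin> rays n M p" if "k \<in> K" for k
      using xlit_notin[OF rays[of k u]] K[OF that] W by blast
    then show ?thesis by auto
  qed
  moreover have "xlit i u \<notin> (\<lambda>k. xlit k u) ` K" using iu by (auto simp: K_def)
  ultimately have "derives (insert (edge i u) V) S (insert (xlit i u) (min_clause W i))
    (insert (xlit i u) (min_clause W i) \<union> N) (m + 2 * n) S2"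
    using \<open>card K \<le> n\<close> \<open>i \<in> W\<close>
    by (intro derives_weaken[OF S2(1)]) (auto simp: E K_def R_def min_clause_def)
  with S2(2) show ?thesis by blast
qed

text \<open>Resolves the clause of \<open>u\<close>, transformed as above, with the clause of
  \<open>i\<close> from before the elimination. The second derivation is assumed for every larger
  \<open>S'\<close>, since it runs after the first and its chain.\<close>

lemma derives_eliminate:
  assumes W: "W \<subseteq> M" "u \<in> M" "u \<notin> W" "i \<in> W"
    and V: "free {u} V" and S: "S0 \<subseteq> S"
    and D1: "derives (V \<union> (\<lambda>j. edge j u) ` W) S
      (min_clause (insert u W) u) (min_clause (insert u W) u \<union> N) m1 S1"
    and D2: "\<And>S'. S1 \<subseteq> S' \<Longrightarrow> \<exists>S''. derives (insert (edge i u) V) S'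
      (min_clause (insert u W) i) (min_clause (insert u W) i \<union> N) m2 S''"
  shows "\<exists>S'. derives V S (min_clause W i) (min_clause W i \<union> N) (m1 + m2 + 2 * n + 1) S' \<and> S1 \<subseteq> S'"
proof -
  obtain S2 where S2: "derives (insert (edge i u) V) S (insert (xlit i u) (min_clause W i))
    (insert (xlit i u) (min_clause W i) \<union> N) (m1 + 2 * n) S2" "S1 \<subseteq> S2"
    using derives_eliminated[OF W V S D1] by blast
  obtain S3 where S3: "derives (insert (edge i u) V) S2
      (min_clause (insert u W) i) (min_clause (insert u W) i \<union> N) m2 S3"
    using D2[OF S2(2)] by blast
  have iu: "i \<noteq> u" "i \<in> M" using W by auto
  have N: "xlit i u \<notin> N \<and> xlit u i \<notin> N"
    using edge_in_N[of i u] iu W xlit_notin by blast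
  then have Q: "xlit i u \<notin> rays n M p" "xlit u i \<notin> rays n M p"
    using rays_subset[OF star] by auto
  have c: "min_clause (insert u W) i = insert (xlit u i) (min_clause W i)"
    using iu W by (auto simp: min_clause_def)
  have m: "xlit i u \<notin> min_clause W i" "xlit u i \<notin> min_clause W i"
    using Q iu W by (auto simp: min_clause_def)
  have "\<exists>S'. derives V S (min_clause W i) (min_clause W i \<union> N) (m1 + m2 + 2 * n + 1) S' \<and> S3 \<subseteq> S'"
    by (rule derives_node[OF S2(1) _ _ S3])
      (use c m N iu V W in \<open>auto simp: free_def edge_commute\<close>)
  then show ?thesis using S2(2) derives_mono[OF S3] by blast
qed

text \<open>With the diagonal lemmas at hand only the clause of \<open>i\<close> is followed
  recursively; a level adds one leaf, a chain of at most \<open>2 * n\<close> nodes and one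
  resolvent.\<close>

lemma derives_with_diag:
  assumes "distinct us" "set us \<subseteq> M" "i \<in> M - set us" "free (set us) V" "S0 \<subseteq> S" "diag us S"
  shows "\<exists>S'. derives V S (min_clause (M - set us) i) (min_clause (M - set us) i \<union> N)
    ((2 * n + 2) * (length us + 1)) S'"
  using assms
proof (induction us arbitrary: V S)
  case Nil
  then obtain S' where "derives V S (min_clause M i) (min_clause M i \<union> N) (2 * n + 1) S'"
    using derives_min_clause_M[of i "{}" V S] by auto
  then have "derives V S (min_clause M i) (min_clause M i \<union> N) (2 * n + 2) S'"
    by (rule derives_weaken) auto
  then show ?case by auto
next
  case (Cons u us)
  let ?W = "M - set (u # us)"
  have W: "insert u ?W = M - set us" using Cons.prems by auto
  have fr: "free (set us) (insert (edge i u) V)"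
    using Cons.prems by (auto simp: free_def)
  have "\<exists>S'. derives V S (min_clause ?W i) (min_clause ?W i \<union> N)
    (1 + (2 * n + 2) * (length us + 1) + 2 * n + 1) S' \<and> S \<subseteq> S'"
  proof (rule derives_eliminate)
    show "derives (V \<union> (\<lambda>j. edge j u) ` ?W) S (min_clause (insert u ?W) u)
      (min_clause (insert u ?W) u \<union> N) 1 S"
      unfolding W using Cons.prems by (intro derives_avail) simp
    fix S' assume "S \<subseteq> S'"
    then show "\<exists>S''. derives (insert (edge i u) V) S' (min_clause (insert u ?W) i)
      (min_clause (insert u ?W) i \<union> N) ((2 * n + 2) * (length us + 1)) S''"
      unfolding W using Cons.prems fr by (intro Cons.IH) (auto intro: diag_mono)
  qed (use Cons.prems in \<open>auto simp: free_def\<close>)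
  then show ?case by (auto intro: derives_weaken)
qed

text \<open>The clause of \<open>u\<close> is derived in full, which also fills the diagonal of
  \<open>us\<close>; the clause of \<open>i\<close> is then cheap. With one full recursive call per
  level the size grows quadratically in the length instead of doubling.\<close>

lemma derives_and_diag:
  assumes "distinct us" "set us \<subseteq> M" "i \<in> M - set us" "free (set us) V" "S0 \<subseteq> S"
  shows "\<exists>S'. derives V S (min_clause (M - set us) i) (min_clause (M - set us) i \<union> N)
    ((2 * n + 2) * (length us + 1)^2) S' \<and> diag us S'"
  using assms
proof (induction us arbitrary: V S i)
  case Nil
  then obtain S' where "derives V S (min_clause M i) (min_clause M i \<union> N) (2 * n + 1) S'"
    using derives_min_clause_M[of i "{}" V S] by auto
  then have "derives V S (min_clause M i) (min_clause M i \<union> N) (2 * n + 2) S'"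
    by (rule derives_weaken) auto
  then show ?case by auto
next
  case (Cons u us)
  let ?W = "M - set (u # us)"
  let ?l = "length us"
  have W: "insert u ?W = M - set us" using Cons.prems by auto
  have fr1: "free (set us) (V \<union> (\<lambda>j. edge j u) ` ?W)"
    using Cons.prems by (auto simp: free_def)
  have fr2: "free (set us) (insert (edge i u) V)"
    using Cons.prems by (auto simp: free_def)
  obtain S1 where S1: "derives (V \<union> (\<lambda>j. edge j u) ` ?W) S (min_clause (insert u ?W) u)
      (min_clause (insert u ?W) u \<union> N) ((2 * n + 2) * (?l + 1)^2) S1" "diag us S1"
    unfolding W using Cons.IH[OF _ _ _ fr1, of u S] Cons.prems by auto
  \<comment> \<open>The root label of the subtree just built is the lemma recorded for
    \<open>u\<close>.\<close>
  then have diag: "diag (u # us) S1"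
    using derives_label[OF S1(1)] W by (auto simp: avail_def)
  have "\<exists>S'. derives V S (min_clause ?W i) (min_clause ?W i \<union> N)
    ((2 * n + 2) * (?l + 1)^2 + (2 * n + 2) * (?l + 1) + 2 * n + 1) S' \<and> S1 \<subseteq> S'"
  proof (rule derives_eliminate[OF _ _ _ _ _ _ S1(1)])
    fix S' assume "S1 \<subseteq> S'"
    then show "\<exists>S''. derives (insert (edge i u) V) S' (min_clause (insert u ?W) i)
      (min_clause (insert u ?W) i \<union> N) ((2 * n + 2) * (?l + 1)) S''"
      unfolding W using Cons.prems fr2 S1(2) derives_mono[OF S1(1)]
      by (intro derives_with_diag) (auto intro: diag_mono)
  qed (use Cons.prems in \<open>auto simp: free_def\<close>)
  then obtain S' where S': "derives V S (min_clause ?W i) (min_clause ?W i \<union> N)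
    ((2 * n + 2) * (?l + 1)^2 + (2 * n + 2) * (?l + 1) + 2 * n + 1) S'" "S1 \<subseteq> S'" by blast
  have "(2 * n + 2) * (?l + 1)^2 + (2 * n + 2) * (?l + 1) + 2 * n + 1
      \<le> (2 * n + 2) * (length (u # us) + 1)^2"
    by (simp add: power2_eq_square algebra_simps)
  then have "derives V S (min_clause ?W i) (min_clause ?W i \<union> N)
    ((2 * n + 2) * (length (u # us) + 1)^2) S'"
    using derives_weaken[OF S'(1) order_refl order_refl] by blast
  then show ?case using diag_mono[OF diag S'(2)] by blast
qed

lemma derives_rays:
  "\<exists>S'. derives (var_of ` N) S0 (rays n M p) N ((2 * n + 2) * (n + 1)^2) S'"
proof -
  obtain i where i: "i \<in> M" using star by (auto simp: star_def)
  \<comment> \<open>All elements but \<open>i\<close> are eliminated; the minimality clause of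
    \<open>i\<close> within \<open>{i}\<close> consists of rays only.\<close>
  obtain us where us: "distinct us" "set us = M - {i}"
    using finite_M by (metis finite_Diff finite_distinct_list)
  have "free (set us) (var_of ` N)"
    unfolding free_def using us edge_in_N edge_commute by (metis Diff_subset subsetD)
  then obtain S' where "derives (var_of ` N) S0 (min_clause (M - set us) i)
    (min_clause (M - set us) i \<union> N) ((2 * n + 2) * (length us + 1)^2) S'"
    using derives_and_diag[of us i "var_of ` N" S0] us i by auto
  moreover have "min_clause (M - set us) i = rays n M p"
    using us i by (auto simp: min_clause_def)
  moreover have "length us \<le> n"
  proof -
    have "length us = card (set us)" using us distinct_card by metis
    also have "\<dots> \<le> card {..<n}" using us M_less by (intro card_mono) auto
    finally show ?thesis by simp
  qed
  then have "(2 * n + 2) * (length us + 1)^2 \<le> (2 * n + 2) * (n + 1)^2"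
    by (intro mult_left_mono power_mono) auto
  ultimately have "derives (var_of ` N) S0 (rays n M p) N ((2 * n + 2) * (n + 1)^2) S'"
    using rays_subset[OF star] by (elim derives_weaken) auto
  then show ?thesis ..
qed

end

section \<open>Learning the cyclic clauses\<close>

text \<open>\<open>derives_node\<close> in search form, where each child falsifies one more literal.
  The first child keeps its own bound \<open>U1\<close>, as it may be a freshly learned
  clause.\<close>

lemma derives_branch:
  assumes "a \<noteq> b" "edge a b \<notin> var_of ` N"
    and 1: "derives (var_of ` insert (xlit a b) N) S E1 U1 k1 S1" "xlit a b \<in> E1"
      "U1 \<subseteq> insert (xlit a b) N"
    and 2: "derives (var_of ` insert (xlit b a) N) S1 E2 (insert (xlit b a) N) k2 S2" "xlit b a \<in> E2"
    and E: "E \<subseteq> (E1 - {xlit a b}) \<union> (E2 - {xlit b a})"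
  shows "\<exists>S'. derives (var_of ` N) S E N (k1 + k2 + 1) S' \<and> S2 \<subseteq> S'"
proof -
  have N: "xlit a b \<notin> N" "xlit b a \<notin> N" using xlit_notin[OF assms(2)] by auto
  have D1: "derives (insert (edge a b) (var_of ` N)) S E1 U1 k1 S1"
    using 1(1) by (simp add: edge_commute)
  have D2: "derives (insert (edge a b) (var_of ` N)) S1 E2 (insert (xlit b a) N) k2 S2"
    using 2(1) by (simp add: edge_commute)
  show ?thesis
    by (rule derives_node[OF D1 _ _ D2]) (use assms N in auto)
qed

context ggt
begin

definition cyclic_clauses :: "(nat \<times> nat) clause set" where
  "cyclic_clauses = {T_clause a b c | a b c. distinct_triple n a b c}"

lemma cyclic_clauses: "finite cyclic_clauses" "card cyclic_clauses \<le> n ^ 3"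
proof -
  let ?A = "{..<n} \<times> {..<n} \<times> {..<n}"
  have sub: "cyclic_clauses \<subseteq> (\<lambda>(a, b, c). T_clause a b c) ` ?A"
    by (force simp: cyclic_clauses_def distinct_triple_def)
  then show "finite cyclic_clauses"
    by (rule finite_subset) simp
  have "card cyclic_clauses \<le> card ((\<lambda>(a, b, c). T_clause a b c) ` ?A)"
    using sub by (intro card_mono) auto
  also have "\<dots> \<le> card ?A"
    by (rule card_image_le) simp
  finally show "card cyclic_clauses \<le> n ^ 3"
    by (simp add: card_cartesian_product power3_eq_cube)
qed

text \<open>The potential of the amortisation. Exact membership, unlike \<open>avail\<close>, does
  not depend on the path.\<close>

definition learned :: "(nat \<times> nat) clause set \<Rightarrow> nat" where
  "learned S = card (cyclic_clauses \<inter> S)"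

lemma learned_mono: "S \<subseteq> S' \<Longrightarrow> learned S \<le> learned S'"
  unfolding learned_def using cyclic_clauses(1) by (intro card_mono) auto

lemma learned_less:
  assumes "S \<subseteq> S'" "distinct_triple n a b c" "T_clause a b c \<notin> S" "T_clause a b c \<in> S'"
  shows "learned S < learned S'"
proof -
  have "T_clause a b c \<in> cyclic_clauses"
    using assms(2) by (auto simp: cyclic_clauses_def)
  then have "cyclic_clauses \<inter> S \<subset> cyclic_clauses \<inter> S'"
    using assms by blast
  then show ?thesis
    unfolding learned_def using cyclic_clauses(1) by (intro psubset_card_mono) auto
qed

section \<open>Merging minimal elements\<close>

text \<open>Once \<open>k\<close> is put below \<open>j\<close>, the cycle \<open>j\<close>,
  \<open>p k\<close>, \<open>k\<close> is falsified. \<open>refute_T\<close> derives it on the spot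
  with at most three nodes, and the resolvent makes four.\<close>

lemma derives_merge_chain:
  assumes "finite K" "GGT n r s \<subseteq> S"
    and "\<And>k. k \<in> K \<Longrightarrow> distinct_triple n j (p k) k \<and> xlit (p k) j \<in> N \<and> xlit k (p k) \<in> N \<and>
      edge k j \<notin> var_of ` N"
    and "derives (var_of ` (N \<union> (\<lambda>k. xlit k j) ` K)) S E (N \<union> (\<lambda>k. xlit k j) ` K) m S1"
    and "(\<lambda>k. xlit k j) ` K \<subseteq> E"
  shows "\<exists>S2. derives (var_of ` N) S ((E - (\<lambda>k. xlit k j) ` K) \<union> (\<lambda>k. xlit k (p k)) ` K) N
    (m + 4 * card K) S2 \<and> S1 \<subseteq> S2"
  using assms
proof (induction K arbitrary: N)
  case empty
  then show ?case by auto
next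
  case (insert x F)
  let ?E = "(E - (\<lambda>k. xlit k j) ` F) \<union> (\<lambda>k. xlit k (p k)) ` F"
  have x: "distinct_triple n j (p x) x" "xlit (p x) j \<in> N" "xlit x (p x) \<in> N" "edge x j \<notin> var_of ` N"
    using insert.prems(2)[of x] by auto
  then have ne: "x \<noteq> j" "p x \<noteq> j" "x \<noteq> p x" by (auto simp: distinct_triple_def)
  have "\<exists>S2. derives (var_of ` insert (xlit x j) N) S ?E (insert (xlit x j) N)
      (m + 4 * card F) S2 \<and> S1 \<subseteq> S2"
  proof (rule insert.IH)
    show "distinct_triple n j (p k) k \<and> xlit (p k) j \<in> insert (xlit x j) N \<and>
        xlit k (p k) \<in> insert (xlit x j) N \<and> edge k j \<notin> var_of ` insert (xlit x j) N"
      if "k \<in> F" for k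
    proof -
      have "k \<noteq> x" using that insert.hyps by auto
      then show ?thesis using insert.prems(2)[of k] that ne by auto
    qed
    have "insert (xlit x j) N \<union> (\<lambda>k. xlit k j) ` F = N \<union> (\<lambda>k. xlit k j) ` insert x F"
      by blast
    then show "derives (var_of ` (insert (xlit x j) N \<union> (\<lambda>k. xlit k j) ` F)) S E
        (insert (xlit x j) N \<union> (\<lambda>k. xlit k j) ` F) m S1"
      using insert.prems(3) by simp
  qed (use insert.prems in auto)
  then obtain S2 where S2: "derives (var_of ` insert (xlit x j) N) S ?E (insert (xlit x j) N)
      (m + 4 * card F) S2" "S1 \<subseteq> S2" by blast
  have T: "T_clause j (p x) x = {xlit (p x) j, xlit x (p x), xlit j x}"
    using ne by (simp add: T_clause_eq)
  have "GGT n r s \<subseteq> S2" using insert.prems(1) derives_mono[OF S2(1)] by blast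
  then obtain S3 where S3: "derives (var_of ` insert (xlit j x) N) S2
      {xlit (p x) j, xlit x (p x), xlit j x} (insert (xlit j x) N) 3 S3"
    using refute_T[OF x(1), of S2 "insert (xlit j x) N"] x T by auto
  have xE: "xlit x j \<in> ?E" using insert.prems(4) insert.hyps ne by auto
  have "\<exists>S'. derives (var_of ` N) S
      ((E - (\<lambda>k. xlit k j) ` insert x F) \<union> (\<lambda>k. xlit k (p k)) ` insert x F) N
      (m + 4 * card F + 3 + 1) S' \<and> S3 \<subseteq> S'"
  proof (rule derives_branch[OF ne(1) x(4) S2(1) xE order_refl S3])
    have "xlit k (p k) \<noteq> xlit x j" if "k \<in> F" for k
      using that insert.hyps ne by auto
    then show "(E - (\<lambda>k. xlit k j) ` insert x F) \<union> (\<lambda>k. xlit k (p k)) ` insert x F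
      \<subseteq> (?E - {xlit x j}) \<union> ({xlit (p x) j, xlit x (p x), xlit j x} - {xlit j x})"
      using ne by auto
  qed simp
  then show ?case using insert.hyps S2(2) derives_mono[OF S3] by (auto simp: algebra_simps)
qed

text \<open>
  The elements of \<open>I\<close> are put above \<open>j\<close>. For each \<open>k\<close> above some \<open>i \<in> I\<close> one branches on the order of
  \<open>j\<close> and \<open>k\<close>; the branch with \<open>k\<close> below \<open>j\<close> is closed by the cycle \<open>j, i, k\<close>. The set \<open>L\<close> contains
  those \<open>k\<close> that are already known to be above \<open>j\<close>.
\<close>

lemma derives_merge:
  assumes star: "star n M p N" and j: "j \<in> M" "j \<notin> I" and I: "I \<subseteq> M"
    and L: "L \<subseteq> {k. k < n \<and> k \<notin> M \<and> p k \<in> I}"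
    and N1: "N1 = N \<union> (\<lambda>i. xlit i j) ` I \<union> (\<lambda>k. xlit k j) ` L \<union> X"
    and X: "\<And>l. l \<in> X \<Longrightarrow> \<exists>a\<in>I. \<exists>b\<in>I. l = xlit a b"
    and S: "GGT n r s \<subseteq> S"
    and IH: "\<And>p' N'. star n (M - I) p' N' \<Longrightarrow>
      \<exists>m S'. derives (var_of ` N') S (rays n (M - I) p') N' m S' \<and>
        m + c * learned S \<le> q + c * learned S'"
  shows "\<exists>m S'. derives (var_of ` N1) S
      ((rays n M p - (\<lambda>k. xlit k (p k)) ` L) \<union> (\<lambda>i. xlit i j) ` I \<union> (\<lambda>k. xlit k j) ` L) N1 m S' \<and>
    m + c * learned S \<le> q + 4 * n + c * learned S'"
proof -
  define K where "K = {k. k < n \<and> k \<notin> M \<and> p k \<in> I} - L"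
  define N' where "N' = N1 \<union> (\<lambda>k. xlit k j) ` K"
  \<comment> \<open>All of \<open>I\<close>, and whatever was above an element of \<open>I\<close>,
    is now recorded above \<open>j\<close>.\<close>
  define p' where "p' x = (if x \<in> I \<or> x \<notin> M \<and> p x \<in> I then j else p x)" for x
  have M: "a < n" if "a \<in> M" for a using star that by (auto simp: star_def)
  have pk: "p k \<in> M" "xlit k (p k) \<in> N" if "k < n" "k \<notin> M" for k
    using star that by (auto simp: star_def)
  have eN: "b \<notin> M \<and> p b = a" if "edge a b \<in> var_of ` N" "a \<in> M" "a \<noteq> b" for a b
    using star that unfolding star_def by blast
  have star': "star n (M - I) p' N'"
    unfolding star_def
  proof (intro conjI allI impI ballI)
    show "M - I \<subseteq> {..<n}" "M - I \<noteq> {}" using M j by auto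
  next
    fix k assume k: "k < n" "k \<notin> M - I"
    show "p' k \<in> M - I" using k pk[of k] j by (auto simp: p'_def)
    show "xlit k (p' k) \<in> N'"
      using k pk[of k] I by (auto simp: p'_def N'_def N1 K_def)
  next
    \<comment> \<open>A literal new in \<open>N'\<close> meets \<open>M - I\<close> at most in
      \<open>j\<close>, and its other end then has \<open>j\<close> as its value of
      \<open>p'\<close>.\<close>
    fix a b assume a: "a \<in> M - I" "a \<noteq> b" and e: "edge a b \<in> var_of ` N'"
    from e obtain l where l: "l \<in> N'" "edge a b = var_of l" by auto
    then consider "l \<in> N" | i where "i \<in> I" "l = xlit i j"
      | k where "k < n" "k \<notin> M" "p k \<in> I" "l = xlit k j" | a' b' where "a' \<in> I" "b' \<in> I" "l = xlit a' b'"
      using X L unfolding N'_def N1 K_def by blast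
    then have "b \<notin> M - I \<and> p' b = a"
    proof cases
      case 1
      then have "b \<notin> M \<and> p b = a" using eN[of a b] l a by auto
      then show ?thesis using a I by (auto simp: p'_def)
    next
      case 2
      then show ?thesis using l a j by (auto simp: p'_def)
    next
      case 3
      then show ?thesis using l a j by (auto simp: p'_def)
    next
      case 4
      then show ?thesis using l a by auto
    qed
    then show "b \<notin> M - I" "p' b = a" by auto
  qed
  obtain m S1 where S1: "derives (var_of ` N') S (rays n (M - I) p') N' m S1"
    "m + c * learned S \<le> q + c * learned S1"
    using IH[OF star'] by blast
  have "finite K" "card K \<le> n"
    using finite_subset[of K "{..<n}"] card_mono[of "{..<n}" K] by (auto simp: K_def)
  have "\<exists>S2. derives (var_of ` N1) S
      ((rays n (M - I) p' - (\<lambda>k. xlit k j) ` K) \<union> (\<lambda>k. xlit k (p k)) ` K) N1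
    (m + 4 * card K) S2 \<and> S1 \<subseteq> S2"
  proof (rule derives_merge_chain[OF \<open>finite K\<close> S])
    fix k assume "k \<in> K"
    then have k: "k < n" "k \<notin> M" "p k \<in> I" "k \<notin> L" by (auto simp: K_def)
    have "edge k j \<notin> var_of ` N"
      using eN[of j k] k j edge_commute[of j k] by auto
    moreover have "edge k j \<notin> var_of ` X"
      using X k I by fastforce
    moreover have "edge k j \<notin> var_of ` (\<lambda>i. xlit i j) ` I"
      using k I by auto
    moreover have "edge k j \<notin> var_of ` (\<lambda>i. xlit i j) ` L"
      using k L j by auto
    ultimately have "edge k j \<notin> var_of ` N1"
      unfolding N1 image_Un by blast
    then show "distinct_triple n j (p k) k \<and> xlit (p k) j \<in> N1 \<and> xlit k (p k) \<in> N1 \<and>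
      edge k j \<notin> var_of ` N1"
      using k pk[of k] j I M by (auto simp: distinct_triple_def N1)
  next
    show "derives (var_of ` (N1 \<union> (\<lambda>k. xlit k j) ` K)) S (rays n (M - I) p')
      (N1 \<union> (\<lambda>k. xlit k j) ` K) m S1"
      using S1(1) by (simp only: N'_def)
    show "(\<lambda>k. xlit k j) ` K \<subseteq> rays n (M - I) p'"
      by (force simp: K_def rays_def p'_def)
  qed
  then obtain S2 where S2: "derives (var_of ` N1) S
      ((rays n (M - I) p' - (\<lambda>k. xlit k j) ` K) \<union> (\<lambda>k. xlit k (p k)) ` K) N1
    (m + 4 * card K) S2" "S1 \<subseteq> S2" by blast
  have keep: "xlit k (p' k) \<in> rays n (M - I) p' - (\<lambda>k. xlit k j) ` K"
    if "k < n" "k \<notin> M - I" "k \<notin> K" for k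
  proof -
    have "xlit k (p' k) \<notin> (\<lambda>k. xlit k j) ` K"
    proof
      assume "xlit k (p' k) \<in> (\<lambda>k. xlit k j) ` K"
      then obtain k' where "k' \<in> K" "xlit k (p' k) = xlit k' j" by auto
      moreover have "k' \<noteq> j" using \<open>k' \<in> K\<close> j by (auto simp: K_def)
      ultimately show False using that by auto
    qed
    then show ?thesis using that by (auto simp: rays_def)
  qed
  have "derives (var_of ` N1) S
      ((rays n M p - (\<lambda>k. xlit k (p k)) ` L) \<union> (\<lambda>i. xlit i j) ` I \<union> (\<lambda>k. xlit k j) ` L) N1
      (m + 4 * n) S2"
  proof (rule derives_weaken[OF S2(1)])
    show "(rays n M p - (\<lambda>k. xlit k (p k)) ` L) \<union> (\<lambda>i. xlit i j) ` I \<union> (\<lambda>k. xlit k j) ` L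
      \<subseteq> (rays n (M - I) p' - (\<lambda>k. xlit k j) ` K) \<union> (\<lambda>k. xlit k (p k)) ` K" (is "_ \<subseteq> ?R")
    proof -
      have RI: "xlit i j \<in> ?R" if "i \<in> I" for i
        using keep[of i] that I M by (auto simp: p'_def K_def)
      have RL: "xlit k j \<in> ?R" if "k \<in> L" for k
        using keep[of k] that L by (auto simp: p'_def K_def)
      have RK: "xlit k (p k) \<in> ?R" if "k < n" "k \<notin> M" "k \<notin> L" for k
      proof (cases "p k \<in> I")
        case True
        then show ?thesis using that by (auto simp: K_def)
      next
        case False
        moreover have "k \<notin> I" using that I by auto
        ultimately show ?thesis using keep[of k] that by (auto simp: p'_def K_def)
      qed
      show ?thesis
      proof
        fix l assume "l \<in> (rays n M p - (\<lambda>k. xlit k (p k)) ` L) \<union> (\<lambda>i. xlit i j) ` I \<union>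
          (\<lambda>k. xlit k j) ` L"
        then consider k where "k < n" "k \<notin> M" "k \<notin> L" "l = xlit k (p k)"
          | i where "i \<in> I" "l = xlit i j" | k where "k \<in> L" "l = xlit k j"
          unfolding rays_def by blast
        then show "l \<in> ?R"
        proof cases
          case (1 k)
          show ?thesis using RK[OF 1(1-3)] by (simp only: 1(4))
        next
          case (2 i)
          show ?thesis using RI[OF 2(1)] by (simp only: 2(2))
        next
          case (3 k)
          show ?thesis using RL[OF 3(1)] by (simp only: 3(2))
        qed
      qed
    qed
  qed (use \<open>card K \<le> n\<close> in auto)
  moreover have "m + 4 * n + c * learned S \<le> q + 4 * n + c * learned S2"
    using S1(2) mult_le_mono2[OF learned_mono[OF S2(2)], of c] by linarith
  ultimately show ?thesis by blast
qed

section \<open>Amortised size of the refutation\<close>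

text \<open>Dominates the direct refutation as well as the overhead of a branching: at most three
  merges with \<open>4 * n\<close> extra nodes each, three nodes for the learned clause and three
  resolvents.\<close>

definition base_size :: nat where
  "base_size = 12 * (n + 1) ^ 3"

lemma base_size: "(2 * n + 2) * (n + 1)^2 \<le> base_size" "12 * n + 6 \<le> base_size"
proof -
  show "(2 * n + 2) * (n + 1)^2 \<le> base_size"
    by (simp add: base_size_def power2_eq_square power3_eq_cube)
  have "n + 1 \<le> (n + 1) ^ 3" by (rule self_le_power) auto
  then show "12 * n + 6 \<le> base_size" by (simp add: base_size_def)
qed

text \<open>
  Amortisation: each branching costs three direct refutations and \<open>12 * n + 6\<close> further nodes, paid for
  by the new learned clause.
\<close>

lemma derives_star:
  assumes "star n M p N" "GGT n r s \<subseteq> S"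
  shows "\<exists>m S'. derives (var_of ` N) S (rays n M p) N m S' \<and>
    m + 3 * base_size * learned S \<le> base_size + 3 * base_size * learned S'"
  using assms
proof (induction "card M" arbitrary: M p N S rule: less_induct)
  case less
  note star = less.prems(1) and S = less.prems(2)
  have M: "a < n" if "a \<in> M" for a using star that by (auto simp: star_def)
  have finM: "finite M" using M finite_subset[of M "{..<n}"] by auto
  have eN: "b \<notin> M \<and> p b = a" if "edge a b \<in> var_of ` N" "a \<in> M" "a \<noteq> b" for a b
    using star that unfolding star_def by blast
  have raysN: "rays n M p \<subseteq> N" using star by (rule rays_subset)
  have merge: "\<exists>m S''. derives (var_of ` N1) S'
      ((rays n M p - (\<lambda>k. xlit k (p k)) ` L) \<union> (\<lambda>i. xlit i j) ` I \<union> (\<lambda>k. xlit k j) ` L) N1 m S'' \<and>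
    m + 3 * base_size * learned S' \<le> base_size + 4 * n + 3 * base_size * learned S''"
    if "j \<in> M" "j \<notin> I" "I \<subseteq> M" "I \<noteq> {}" "L \<subseteq> {k. k < n \<and> k \<notin> M \<and> p k \<in> I}"
      "N1 = N \<union> (\<lambda>i. xlit i j) ` I \<union> (\<lambda>k. xlit k j) ` L \<union> X"
      "\<And>l. l \<in> X \<Longrightarrow> \<exists>a\<in>I. \<exists>b\<in>I. l = xlit a b" "S \<subseteq> S'" for j I L N1 X S'
  proof (rule derives_merge[OF star that(1,2,3,5,6,7)])
    show "GGT n r s \<subseteq> S'" using S that by blast
    fix p' N' assume "star n (M - I) p' N'"
    moreover have "card (M - I) < card M"
      using finM that by (intro psubset_card_mono) auto
    ultimately show "\<exists>m S''. derives (var_of ` N') S' (rays n (M - I) p') N' m S'' \<and>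
        m + 3 * base_size * learned S' \<le> base_size + 3 * base_size * learned S''"
      using less.hyps \<open>GGT n r s \<subseteq> S'\<close> by blast
  qed
  \<comment> \<open>The guard variable is not one of the cycle, so it stays unassigned when the
    literals of the cycle are added to the path.\<close>
  have learn: "\<exists>S'. derives (var_of ` N') S (T_clause a b c) (T_clause a b c) 3 S' \<and>
      learned S + 1 \<le> learned S'"
    if T: "distinct_triple n a b c" "\<not> avail S N (T_clause a b c)"
      and N': "T_clause a b c \<subseteq> N'" "N' \<subseteq> N \<union> T_clause a b c" for a b c N'
  proof -
    have "edge (r a b c) (s a b c) \<notin> var_of ` N'"
      using not_avail(1)[OF T(1) S T(2)] guarded_clauses(4)[OF T(1)] N' by blast
    then obtain S' where S': "derives (var_of ` N') S (T_clause a b c) (T_clause a b c) 3 S'"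
      using learn_T[OF T(1) S N'(1)] by blast
    then have "T_clause a b c \<in> S'" using derives_label by fastforce
    then have "learned S < learned S'"
      using learned_less[OF derives_mono[OF S'] T(1) not_avail(2)[OF T(1) S T(2)]] by blast
    then show ?thesis using S' by auto
  qed
  show ?case
  proof (cases "\<forall>E\<in>needed n M p. avail S N E")
    case True
    then interpret ggt_star n r s M p N S
      using star S by unfold_locales auto
    obtain S' where S': "derives (var_of ` N) S (rays n M p) N ((2 * n + 2) * (n + 1)^2) S'"
      using derives_rays by blast
    have "3 * base_size * learned S \<le> 3 * base_size * learned S'"
      using learned_mono[OF derives_mono[OF S']] by simp
    then show ?thesis using S' base_size(1) add_mono by blast
  next
    case False
    then consider (triangle) a b c where "a \<in> M" "b \<in> M" "c \<in> M" "a \<noteq> b" "b \<noteq> c" "c \<noteq> a"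
        "\<not> avail S N (T_clause a b c)"
      | (ray) k i where "k < n" "k \<notin> M" "i \<in> M" "i \<noteq> p k" "\<not> avail S N (T_clause (p k) k i)"
      unfolding needed_def by blast
    then show ?thesis
    proof cases
      case triangle
      \<comment> \<open>The path puts \<open>a\<close> below \<open>b\<close>, \<open>c\<close>
        below \<open>a\<close> and \<open>b\<close> below \<open>c\<close>, closing the cycle. The
        other outcomes of the third, second and first query leave \<open>c\<close> below
        \<open>a\<close> and \<open>b\<close>, \<open>a\<close> below \<open>b\<close> and
        \<open>c\<close>, and \<open>b\<close> below \<open>a\<close>; \<open>merge\<close> handles
        them in this order.\<close>
      define N1 where "N1 = insert (xlit b a) N"
      define N2 where "N2 = insert (xlit a c) N1"
      have T: "T_clause a b c = {xlit b a, xlit c b, xlit a c}"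
        using triangle by (simp add: T_clause_eq)
      have "distinct_triple n a b c" using triangle M by (auto simp: distinct_triple_def)
      then obtain S1 where S1:
          "derives (var_of ` insert (xlit c b) N2) S (T_clause a b c) (T_clause a b c) 3 S1"
          "learned S + 1 \<le> learned S1"
        using learn[of a b c "insert (xlit c b) N2"] triangle(7)
        unfolding N1_def N2_def T by blast
      have "S \<subseteq> S1" using S1 derives_mono by blast
      then obtain m3 S3 where S3: "derives (var_of ` insert (xlit b c) N2) S1
          (rays n M p \<union> {xlit a c, xlit b c}) (insert (xlit b c) N2) m3 S3"
          "m3 + 3 * base_size * learned S1 \<le> base_size + 4 * n + 3 * base_size * learned S3"
        using merge[of c "{a, b}" "{}" "insert (xlit b c) N2" "{xlit b a}" S1] triangle
        by (auto simp: N1_def N2_def insert_commute)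
      have e: "edge a b \<notin> var_of ` N" "edge b c \<notin> var_of ` N" "edge a c \<notin> var_of ` N"
        using eN triangle by blast+
      have e': "edge c b \<notin> var_of ` N2" "edge a c \<notin> var_of ` N1" "edge b a \<notin> var_of ` N"
        using e triangle by (auto simp: N1_def N2_def edge_commute)
      have R: "xlit x y \<notin> rays n M p" if "x \<in> M" "y \<in> M" "x \<noteq> y" for x y
        using raysN eN[of x y] that xlit_notin by blast
      obtain S3' where S3': "derives (var_of ` N2) S (rays n M p \<union> {xlit b a, xlit a c}) N2
          (3 + m3 + 1) S3'" "S3 \<subseteq> S3'"
        using derives_branch[OF _ e'(1) S1(1) _ _ S3(1), of "rays n M p \<union> {xlit b a, xlit a c}"]
          triangle R by (auto simp: T N1_def N2_def)
      have "S \<subseteq> S3'" using derives_mono[OF S3'(1)] .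
      then obtain m2 S2 where S2: "derives (var_of ` insert (xlit c a) N1) S3'
          (rays n M p \<union> {xlit b a, xlit c a}) (insert (xlit c a) N1) m2 S2"
          "m2 + 3 * base_size * learned S3' \<le> base_size + 4 * n + 3 * base_size * learned S2"
        using merge[of a "{b, c}" "{}" "insert (xlit c a) N1" "{}" S3'] triangle
        by (auto simp: N1_def insert_commute)
      obtain S2' where S2': "derives (var_of ` N1) S (rays n M p \<union> {xlit b a}) N1
          (3 + m3 + 1 + m2 + 1) S2'" "S2 \<subseteq> S2'"
        using derives_branch[OF _ e'(2) S3'(1)[unfolded N2_def] _ order_refl S2(1),
            of "rays n M p \<union> {xlit b a}"] triangle R by auto
      have "S \<subseteq> S2'" using derives_mono[OF S2'(1)] .
      then obtain m1 S4 where S4: "derives (var_of ` insert (xlit a b) N) S2'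
          (rays n M p \<union> {xlit a b}) (insert (xlit a b) N) m1 S4"
          "m1 + 3 * base_size * learned S2' \<le> base_size + 4 * n + 3 * base_size * learned S4"
        using merge[of b "{a}" "{}" "insert (xlit a b) N" "{}" S2'] triangle by auto
      obtain S5 where S5: "derives (var_of ` N) S (rays n M p) N
          (3 + m3 + 1 + m2 + 1 + m1 + 1) S5" "S4 \<subseteq> S5"
        using derives_branch[OF _ e'(3) S2'(1)[unfolded N1_def] _ order_refl S4(1), of "rays n M p"]
          triangle R by auto
      have "3 * base_size * (learned S + 1) \<le> 3 * base_size * learned S1"
        "3 * base_size * learned S3 \<le> 3 * base_size * learned S3'"
        "3 * base_size * learned S2 \<le> 3 * base_size * learned S2'"
        "3 * base_size * learned S4 \<le> 3 * base_size * learned S5"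
        using S1(2) learned_mono[OF S3'(2)] learned_mono[OF S2'(2)] learned_mono[OF S5(2)]
        by (intro mult_le_mono2; simp)+
      then have "3 + m3 + 1 + m2 + 1 + m1 + 1 + 3 * base_size * learned S
          \<le> base_size + 3 * base_size * learned S5"
        using S3(2) S2(2) S4(2) base_size(2) unfolding distrib_left by linarith
      with S5(1) show ?thesis by blast
    next
      case ray
      \<comment> \<open>That \<open>j\<close> lies below \<open>k\<close> is already on the path, so
        two queries close the cycle: \<open>i\<close> below \<open>j\<close>, then \<open>k\<close>
        below \<open>i\<close>.\<close>
      define j where "j = p k"
      have j: "j \<in> M" "xlit k j \<in> N"
        using star ray(1,2) by (simp_all add: star_def j_def)
      have "i \<noteq> j" "k \<noteq> j" "k \<noteq> i"
        using ray(2-4) j(1) by (auto simp: j_def)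
      note j = j this
      define N1 where "N1 = insert (xlit j i) N"
      have T: "T_clause j k i = {xlit k j, xlit i k, xlit j i}"
        using j by (simp add: T_clause_eq)
      have "distinct_triple n j k i" using ray j M by (auto simp: distinct_triple_def)
      then obtain S1 where S1:
          "derives (var_of ` insert (xlit i k) N1) S (T_clause j k i) (T_clause j k i) 3 S1"
          "learned S + 1 \<le> learned S1"
        using learn[of j k i "insert (xlit i k) N1"] ray(5) j(2)
        unfolding N1_def T j_def[symmetric] by blast
      have "S \<subseteq> S1" using S1 derives_mono by blast
      \<comment> \<open>Here \<open>i\<close> is below both \<open>j\<close> and \<open>k\<close>,
        hence \<open>L = {k}\<close>. The ray \<open>xlit k j\<close> dropped by this merge comes
        back from the learned clause in the next resolution.\<close>
      then obtain m2 S2 where S2: "derives (var_of ` insert (xlit k i) N1) S1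
          ((rays n M p - {xlit k j}) \<union> {xlit j i, xlit k i}) (insert (xlit k i) N1) m2 S2"
          "m2 + 3 * base_size * learned S1 \<le> base_size + 4 * n + 3 * base_size * learned S2"
        using merge[of i "{j}" "{k}" "insert (xlit k i) N1" "{}" S1] ray j
        by (auto simp: N1_def insert_commute j_def[symmetric])
      have e: "edge i k \<notin> var_of ` N1" "edge j i \<notin> var_of ` N"
        using eN[of i k] eN[of j i] ray j by (auto simp: N1_def)
      have R: "xlit x y \<notin> rays n M p" if "edge x y \<notin> var_of ` N" for x y
        using raysN that xlit_notin by blast
      have e': "edge i k \<notin> var_of ` N" "edge k i \<notin> var_of ` N" "edge i j \<notin> var_of ` N"
        using e by (auto simp: N1_def edge_commute)
      obtain S2' where S2': "derives (var_of ` N1) S (rays n M p \<union> {xlit j i}) N1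
          (3 + m2 + 1) S2'" "S2 \<subseteq> S2'"
        using derives_branch[OF _ e(1) S1(1) _ _ S2(1), of "rays n M p \<union> {xlit j i}"]
          ray j R[OF e'(1)] R[OF e'(2)] by (auto simp: T N1_def)
      have "S \<subseteq> S2'" using derives_mono[OF S2'(1)] .
      then obtain m1 S4 where S4: "derives (var_of ` insert (xlit i j) N) S2'
          (rays n M p \<union> {xlit i j}) (insert (xlit i j) N) m1 S4"
          "m1 + 3 * base_size * learned S2' \<le> base_size + 4 * n + 3 * base_size * learned S4"
        using merge[of j "{i}" "{}" "insert (xlit i j) N" "{}" S2'] ray j by auto
      obtain S5 where S5: "derives (var_of ` N) S (rays n M p) N
          (3 + m2 + 1 + m1 + 1) S5" "S4 \<subseteq> S5"
        using derives_branch[OF _ e(2) S2'(1)[unfolded N1_def] _ order_refl S4(1), of "rays n M p"]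
          j R[OF e(2)] R[OF e'(3)] by auto
      have "3 * base_size * (learned S + 1) \<le> 3 * base_size * learned S1"
        "3 * base_size * learned S2 \<le> 3 * base_size * learned S2'"
        "3 * base_size * learned S4 \<le> 3 * base_size * learned S5"
        using S1(2) learned_mono[OF S2'(2)] learned_mono[OF S5(2)]
        by (intro mult_le_mono2; simp)+
      then have "3 + m2 + 1 + m1 + 1 + 3 * base_size * learned S
          \<le> base_size + 3 * base_size * learned S5"
        using S2(2) S4(2) base_size(2) unfolding distrib_left by linarith
      with S5(1) show ?thesis by blast
    qed
  qed
qed

section \<open>The polynomial bound\<close>

lemma small_refutation:
  assumes "n > 0"
  shows "\<exists>t. pool_resolution_refutation (GGT n r s) t \<and>
    proof_size t \<le> 12 * (n + 1) ^ 3 * (1 + 3 * n ^ 3)"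
proof -
  \<comment> \<open>With every element minimal and nothing on the path, both bounds are empty, so
    the derived clause is the empty one.\<close>
  have "star n {..<n} id {}" using assms by (auto simp: star_def)
  then obtain m S' where S': "derives {} (GGT n r s) (rays n {..<n} id) {} m S'"
    "m + 3 * base_size * learned (GGT n r s) \<le> base_size + 3 * base_size * learned S'"
    using derives_star[of "{..<n}" id "{}" "GGT n r s"] by auto
  then obtain k where k: "k \<le> m" "pool {} (GGT n r s) {} k S'"
    by (auto simp: derives_def)
  then obtain t where t: "pool_resolution_refutation (GGT n r s) t" "proof_size t = k"
    using pool_tree by (metis pool_resolution_refutation_def)
  have "learned S' \<le> n ^ 3"
    using cyclic_clauses card_mono[of cyclic_clauses "cyclic_clauses \<inter> S'"]
    by (auto simp: learned_def)
  then have "3 * base_size * learned S' \<le> 3 * base_size * n ^ 3"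
    by (rule mult_le_mono2)
  then have "k \<le> base_size + 3 * base_size * n ^ 3"
    using k(1) S'(2) by linarith
  then have "k \<le> base_size * (1 + 3 * n ^ 3)"
    by (simp add: algebra_simps)
  then show ?thesis using t unfolding base_size_def by blast
qed

end

theorem theorem1:
  shows "\<exists>p :: real poly. \<forall>n > 1. \<forall>r s. guards n r s \<longrightarrow>
    (\<exists>t. pool_resolution_refutation (GGT n r s) t \<and> real (proof_size t) \<le> poly p (real n))"
proof (rule exI, intro allI impI)
  fix n :: nat and r s assume n: "n > 1" and "guards n r s"
  then interpret ggt n r s by unfold_locales
  obtain t where t: "pool_resolution_refutation (GGT n r s) t"
    "proof_size t \<le> 12 * (n + 1) ^ 3 * (1 + 3 * n ^ 3)"
    using small_refutation n by auto
  have "real (proof_size t) \<le> real (12 * (n + 1) ^ 3 * (1 + 3 * n ^ 3))"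
    using t(2) by (simp only: of_nat_le_iff)
  \<comment> \<open>This supplies the witness left schematic by \<open>exI\<close>:
    \<open>[:1, 1:]\<close> is X + 1 and \<open>[:0, 1:]\<close> is X.\<close>
  also have "\<dots> = poly (smult 12 ([:1, 1:] ^ 3) * (1 + smult 3 ([:0, 1:] ^ 3))) (real n)"
    by (simp add: algebra_simps)
  finally show "\<exists>t. pool_resolution_refutation (GGT n r s) t \<and>
      real (proof_size t) \<le> poly (smult 12 ([:1, 1:] ^ 3) * (1 + smult 3 ([:0, 1:] ^ 3))) (real n)"
    using t(1) by blast
qed

end
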